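(* Let $f:\mathbb{R}^n\to[0,\infty)$ be differentiable, $\mu$-strongly convex for some $\mu>0$ (i.e. $f(x)-\frac{\mu}{2}\|x\|_2^2$ is convex) and $\beta$-smooth for some $\beta>0$ (i.e. $\frac{\beta}{2}\|x\|_2^2-f(x)$ is convex), and assume that $f$ admits a sparse minimizer. Let $\alpha\in(0,1)$, $k_i\in\mathbb{R}$ and $0<\tau<\frac{2}{\beta}$. Put $\sigma^2=\max\{(1-\tau\mu)^2,(1-\tau\beta)^2\}$ and suppose that $$\xi^2:=\max\{\sigma^2+k_i^2\beta^2,\ \tau^2+(1-\alpha)^2\}<\frac12 .$$ Then each step of the I-ISTA iteration $$\begin{cases} x(k+1)=\mathrm{S}_{\tau\lambda(k)}\big(x(k)-\tau\nabla f(x(k))\big)\\ \lambda(k+1)=(1-\alpha)\lambda(k)+k_i\nabla f(x(k))\end{cases}$$ is a contractive map, i.e. the map $(x,\lambda)\mapsto\big(\mathrm{S}_{\tau\lambda}(x-\tau\nabla f(x)),\,(1-\alpha)\lambda+k_i\nabla f(x)\big)$ from $\mathbb{R}^n\times[0,\infty)^n$ to $\mathbb{R}^n\times\mathbb{R}^n$ is Lipschitz with constant strictly less than $1$ in the Euclidean norm; and I-ISTA converges to $(x^\star,\lambda^\star)$, i.e. for every initial condition $(x(0),\lambda(0))\in\mathbb{R}^n\times[0,\infty)^n$ the generated sequence satisfies $(x(k),\lambda(k))\to(x^\star,\lambda^\star)$ as $k\to\infty$, where $\lambda^\star=0$ and $x^\star$ is the unique minimizer of $f$ (so $\nabla f(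x^\star)=0$).
   Context: The shrinkage-thresholding operator $\mathrm{S}_{\tau\lambda}:\mathbb{R}^n\to\mathbb{R}^n$, with $\lambda=(\lambda_1,\dots,\lambda_n)$, acts componentwise: for $z\in\mathbb{R}^n$ its $j$-th component is $$\mathrm{S}_{\tau\lambda_j}(z_j)=\begin{cases} z_j-\mathrm{sign}(z_j)\,\tau\lambda_j & \text{if } |z_j|>\tau\lambda_j,\\ 0&\text{otherwise,}\end{cases}$$ with $\mathrm{sign}(0)=0$. For $\lambda_j\ge 0$ this is the proximal map $\arg\min_{u\in\mathbb{R}}\big[\tau\lambda_j|u|+\frac12(u-z_j)^2\big]$; if along the iteration some $\lambda_j(k)$ becomes negative, the displayed formula is used. The Euclidean norm on $\mathbb{R}^n\times\mathbb{R}^n$ is $\|(x,\lambda)\|^2=\|x\|_2^2+\|\lambda\|_2^2$. The scalar $k_i\in\mathbb{R}$ is a single design parameter (the integral gain); the subscript $i$ is part of its name and not an index. "Sparse" means having many zero components; it plays no further role in the statement. *)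

theory Defs
  imports "HOL-Analysis.Analysis"
begin

definition grad :: "('a::euclidean_space \<Rightarrow> real) \<Rightarrow> 'a \<Rightarrow> 'a" where
  "grad f x = (THE D. GDERIV f x :> D)"

text \<open>The description is well defined wherever \<open>f\<close> is differentiable.\<close>

lemma GDERIV_grad:
  fixes f :: "'a::euclidean_space \<Rightarrow> real"
  assumes "f differentiable (at x)"
  shows "GDERIV f x :> grad f x"
proof -
  obtain f' where f': "(f has_derivative f') (at x)"
    using assms unfolding differentiable_def by blast
  interpret f': linear f'
    using f' by (rule has_derivative_linear)
  define D where "D = (\<Sum>b\<in>Basis. f' b *\<^sub>R b)"
  have "f' h = inner h D" for h
  proof -
    have "f' h = f' (\<Sum>b\<in>Basis. inner h b *\<^sub>R b)"
      by (simp add: euclidean_representation)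
    also have "\<dots> = inner h D"
      by (simp add: f'.sum f'.scaleR D_def inner_sum_right mult.commute)
    finally show ?thesis .
  qed
  then have "f' = (\<lambda>h. inner h D)" by auto
  with f' have D: "GDERIV f x :> D"
    by (simp add: gderiv_def)
  have "E = D" if "GDERIV f x :> E" for E
  proof -
    have "(\<lambda>h. inner h E) = (\<lambda>h. inner h D)"
      using that D unfolding gderiv_def by (rule has_derivative_unique)
    then have "inner h E = inner h D" for h by (rule fun_cong)
    then show ?thesis by (metis vector_eq_ldot)
  qed
  with D show ?thesis
    unfolding grad_def by (rule theI)
qed

definition strongly_convex :: "real \<Rightarrow> ('a::euclidean_space \<Rightarrow> real) \<Rightarrow> bool" where
  "strongly_convex \<mu> f \<longleftrightarrow> convex_on UNIV (\<lambda>x. f x - \<mu> / 2 * (norm x)\<^sup>2)"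

definition beta_smooth :: "real \<Rightarrow> ('a::euclidean_space \<Rightarrow> real) \<Rightarrow> bool" where
  "beta_smooth \<beta> f \<longleftrightarrow> convex_on UNIV (\<lambda>x. \<beta> / 2 * (norm x)\<^sup>2 - f x)"

text \<open>The threshold \<open>t\<close> may be negative; the formula is then used unchanged, and the
  result is no longer the proximal map of \<open>t * \<bar>u\<bar>\<close>.\<close>

definition shrink :: "real \<Rightarrow> real \<Rightarrow> real" where
  "shrink t z = (if \<bar>z\<bar> > t then z - sgn z * t else 0)"

definition shrinkage :: "real ^ 'n \<Rightarrow> real ^ 'n \<Rightarrow> real ^ 'n" where
  "shrinkage t z = (\<chi> j. shrink (t $ j) (z $ j))"

definition ista_step ::
  "(real ^ 'n \<Rightarrow> real) \<Rightarrow> real \<Rightarrow> real \<Rightarrow> real \<Rightarrow> (real ^ 'n) \<times> (real ^ 'n) \<Rightarrow> (real ^ 'n) \<times> (real ^ 'n)" where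
  "ista_step f \<tau> \<alpha> k\<^sub>i = (\<lambda>(x, lam).
     (shrinkage (\<tau> *\<^sub>R lam) (x - \<tau> *\<^sub>R grad f x),
      (1 - \<alpha>) *\<^sub>R lam + k\<^sub>i *\<^sub>R grad f x))"

text \<open>The set \<open>\<real>\<^sup>n \<times> [0,\<infinity>)\<^sup>n\<close>. It need not be invariant under \<open>ista_step\<close>. The product
  type carries the Euclidean norm (\<open>norm_prod_def\<close>).\<close>

definition ista_domain :: "((real ^ 'n) \<times> (real ^ 'n)) set" where
  "ista_domain = UNIV \<times> {lam. \<forall>j. 0 \<le> lam $ j}"

end

theory Submission
  imports Defs
begin

text \<open>
  Both hypotheses on \<open>f\<close> together say that \<open>f - (\<mu> + \<beta>) / 4 * \<parallel>\<cdot>\<parallel>\<^sup>2\<close> is squeezed, at each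
  point, between two tangent paraboloids of curvatures \<open>\<plusminus>(\<beta> - \<mu>) / 2\<close>, so its gradient is Lipschitz with
  constant \<open>(\<beta> - \<mu>) / 2\<close> (\<open>grad_diff_in_ball\<close>). Hence, for \<open>d = x - y\<close>, the difference of the
  gradients of \<open>f\<close> lies in the ball with centre \<open>(\<mu> + \<beta>) / 2 * d\<close> and radius
  \<open>(\<beta> - \<mu>) / 2 * \<parallel>d\<parallel>\<close>. Everything needed about \<open>f\<close> is read off from this ball: the gradient is
  \<open>\<beta>\<close>-Lipschitz, it separates points (so the minimizer is unique), and the gradient step
  \<open>x - \<tau> * grad f x\<close> is Lipschitz with constant \<open>\<sigma> = max \<bar>1 - \<tau> * \<mu>\<bar> \<bar>1 - \<tau> * \<beta>\<bar>\<close>.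

  Shrinkage is nonexpansive in its argument and in its threshold, as long as both thresholds
  are nonnegative. So with \<open>a\<close>, \<open>b\<close> the distances of the two components of a pair of points, the
  components of the images are at distance at most \<open>\<sigma> * a + \<tau> * b\<close> and
  \<open>\<bar>k\<^sub>i\<bar> * \<beta> * a + (1 - \<alpha>) * b\<close>. Squaring with \<open>(u + v)\<^sup>2 \<le> 2 * (u\<^sup>2 + v\<^sup>2)\<close> and adding gives the
  Lipschitz constant \<open>sqrt (2 * \<xi>\<^sup>2) < 1\<close>.

  Convergence does not follow from this contraction property on the domain alone, because an
  iterate may acquire a negative threshold, where shrinkage is discontinuous. But against the
  threshold \<open>0\<close>, at which shrinkage is the identity, the same estimate holds for thresholds of
  either sign (\<open>shrink_diff_le\<close>). As the fixed point \<open>(x\<^sup>\<star>, 0)\<close> has threshold \<open>0\<close>, every step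
  from an arbitrary point decreases the distance to the fixed point by at least that factor.
\<close>

section \<open>Gradients of strongly convex smooth functions\<close>

lemma convex_above_tangent_plane:
  fixes h :: "'a::euclidean_space \<Rightarrow> real"
  assumes "convex_on UNIV h" and "GDERIV h x :> D"
  shows "h x + (y - x) \<bullet> D \<le> h y"
proof -
  define \<phi> where "\<phi> t = h (x + t *\<^sub>R (y - x))" for t :: real
  have "convex_on UNIV \<phi>"
  proof (rule convex_onI)
    fix t u v :: real
    assume "0 < t" "t < 1"
    have "x + ((1 - t) *\<^sub>R u + t *\<^sub>R v) *\<^sub>R (y - x)
        = (1 - t) *\<^sub>R (x + u *\<^sub>R (y - x)) + t *\<^sub>R (x + v *\<^sub>R (y - x))"
      by (simp add: algebra_simps)
    then show "\<phi> ((1 - t) *\<^sub>R u + t *\<^sub>R v) \<le> (1 - t) * \<phi> u + t * \<phi> v"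
      unfolding \<phi>_def using convex_onD[OF assms(1), of t] \<open>0 < t\<close> \<open>t < 1\<close> by simp
  qed simp
  moreover have "(\<phi> has_real_derivative (y - x) \<bullet> D) (at 0)"
  proof -
    have h': "(h has_derivative (\<lambda>v. v \<bullet> D)) (at (x + 0 *\<^sub>R (y - x)))"
      using assms(2) by (simp add: gderiv_def)
    have "((\<lambda>t::real. x + t *\<^sub>R (y - x)) has_derivative (\<lambda>t. t *\<^sub>R (y - x))) (at 0)"
      by (auto intro!: derivative_eq_intros)
    from has_derivative_compose[OF this h'] show ?thesis
      unfolding has_field_derivative_def \<phi>_def by (simp add: mult_commute_abs)
  qed
  ultimately have "\<phi> 1 - \<phi> 0 \<ge> (y - x) \<bullet> D * (1 - 0)"
    by (intro convex_on_imp_above_tangent[where A = UNIV]) auto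
  then show ?thesis by (simp add: \<phi>_def)
qed

lemma GDERIV_quadratic_plus:
  fixes F :: "'a::euclidean_space \<Rightarrow> real"
  assumes "GDERIV F x :> D"
  shows "GDERIV (\<lambda>z. c / 2 * (norm z)\<^sup>2 + s * F z) x :> c *\<^sub>R x + s *\<^sub>R D"
  using assms unfolding gderiv_def power2_norm_eq_inner
  by (auto intro!: derivative_eq_intros simp: inner_simps inner_commute algebra_simps)

text \<open>Strong convexity and smoothness bound \<open>f\<close> below and above by a tangent paraboloid. The
  sign \<open>s\<close> covers both: with \<open>s = 1\<close> and \<open>c = - \<mu>\<close>, or \<open>s = - 1\<close> and \<open>c = \<beta>\<close>.\<close>

lemma convex_quadratic_plus_bound:
  fixes F :: "'a::euclidean_space \<Rightarrow> real"
  assumes "convex_on UNIV (\<lambda>z. c / 2 * (norm z)\<^sup>2 + s * F z)" and "GDERIV F x :> D"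
  shows "s * (F x + (y - x) \<bullet> D) \<le> s * F y + c / 2 * (norm (y - x))\<^sup>2"
proof -
  have "c / 2 * (norm x)\<^sup>2 + s * F x + (y - x) \<bullet> (c *\<^sub>R x + s *\<^sub>R D)
      \<le> c / 2 * (norm y)\<^sup>2 + s * F y"
    by (rule convex_above_tangent_plane[OF assms(1) GDERIV_quadratic_plus[OF assms(2)]])
  moreover have "c / 2 * (norm (y - x))\<^sup>2
      = c / 2 * (norm y)\<^sup>2 - c / 2 * (norm x)\<^sup>2 - c * ((y - x) \<bullet> x)"
    unfolding power2_norm_eq_inner by (simp add: inner_simps inner_commute field_simps)
  ultimately show ?thesis by (simp add: inner_simps algebra_simps)
qed

text \<open>The upper paraboloid at \<open>x\<close> lies above the lower one at \<open>y\<close> and vice versa. Comparing the two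
  pairs at points placed symmetrically about the midpoint of \<open>x\<close> and \<open>y\<close> eliminates the
  values of \<open>F\<close>, and an offset in the direction of the gradient difference gives its norm.\<close>

lemma lipschitz_gradient_of_paraboloid_bounds:
  fixes F :: "'a::euclidean_space \<Rightarrow> real" and G :: "'a \<Rightarrow> 'a"
  assumes bound: "\<And>u v. \<bar>F v - F u - (v - u) \<bullet> G u\<bar> \<le> r / 2 * (norm (v - u))\<^sup>2"
  shows "norm (G x - G y) \<le> r * norm (x - y)"
proof (cases "x = y \<or> G x = G y")
  case True
  have "0 \<le> r * norm (x - y)"
  proof (cases "x = y")
    case False
    have "0 \<le> r / 2 * (norm (y - x))\<^sup>2"
      using bound[of y x] by linarith
    with False have "0 \<le> r" by (simp add: zero_le_mult_iff)
    then show ?thesis by simp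
  qed simp
  with True show ?thesis by auto
next
  case False
  define m where "m = (1 / 2) *\<^sub>R (x + y)"
  \<comment> \<open>Among the offsets in this direction, length \<open>norm (x - y) / 2\<close> gives the best constant.\<close>
  define w where "w = (norm (x - y) / (2 * norm (G x - G y))) *\<^sub>R (G x - G y)"
  have norm_w: "2 * norm w = norm (x - y)"
    using False by (simp add: w_def)
  have inner_w: "2 * (w \<bullet> (G x - G y)) = norm (x - y) * norm (G x - G y)"
    using False by (simp add: w_def power2_norm_eq_inner[symmetric] power2_eq_square)
  have mid: "(norm (m + s *\<^sub>R w - x))\<^sup>2 + (norm (m + s *\<^sub>R w - y))\<^sup>2 = (norm (x - y))\<^sup>2"
    if "s\<^sup>2 = 1" for s
  proof -
    have "(norm (m + s *\<^sub>R w - x))\<^sup>2 + (norm (m + s *\<^sub>R w - y))\<^sup>2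
        = (norm (x - y))\<^sup>2 / 2 + 2 * s\<^sup>2 * (norm w)\<^sup>2"
      unfolding m_def power2_norm_eq_inner
      by (simp add: inner_simps inner_commute field_simps power2_eq_square)
    also have "\<dots> = (norm (x - y))\<^sup>2"
      unfolding norm_w[symmetric] using that by (simp add: power2_eq_square)
    finally show ?thesis .
  qed
  have "F y - F x + (m - w - y) \<bullet> G y - (m - w - x) \<bullet> G x
      \<le> r / 2 * ((norm (m - w - x))\<^sup>2 + (norm (m - w - y))\<^sup>2)"
    using bound[of "m - w" x] bound[of "m - w" y] unfolding distrib_left by linarith
  moreover have "F x - F y + (m + w - x) \<bullet> G x - (m + w - y) \<bullet> G y
      \<le> r / 2 * ((norm (m + w - x))\<^sup>2 + (norm (m + w - y))\<^sup>2)"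
    using bound[of "m + w" x] bound[of "m + w" y] unfolding distrib_left by linarith
  moreover have "2 * (w \<bullet> (G x - G y)) =
      F y - F x + (m - w - y) \<bullet> G y - (m - w - x) \<bullet> G x
      + (F x - F y + (m + w - x) \<bullet> G x - (m + w - y) \<bullet> G y)"
    by (simp add: inner_simps algebra_simps)
  ultimately have "2 * (w \<bullet> (G x - G y)) \<le> r * (norm (x - y))\<^sup>2"
    using mid[of 1] mid[of "-1"] by simp
  then have "norm (x - y) * norm (G x - G y) \<le> norm (x - y) * (r * norm (x - y))"
    unfolding inner_w by (simp add: power2_eq_square mult_ac)
  then show ?thesis using False by simp
qed

text \<open>Subtracting the quadratic of the mean curvature \<open>(\<mu> + \<beta>) / 2\<close> makes the two curvature bounds
  symmetric about \<open>0\<close>. The resulting ball is equivalent to the sharp co-coercivity inequality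
  for the gradient, and no second derivative enters.\<close>

lemma grad_diff_in_ball:
  fixes f :: "'a::euclidean_space \<Rightarrow> real"
  assumes diff: "\<And>x. f differentiable (at x)"
    and sc: "strongly_convex \<mu> f" and sm: "beta_smooth \<beta> f"
  shows "norm (grad f x - grad f y - ((\<mu> + \<beta>) / 2) *\<^sub>R (x - y)) \<le> (\<beta> - \<mu>) / 2 * norm (x - y)"
proof -
  define c where "c = (\<mu> + \<beta>) / 2"
  define F where "F z = f z - c / 2 * (norm z)\<^sup>2" for z
  define G where "G z = grad f z - c *\<^sub>R z" for z
  have "\<bar>F v - F u - (v - u) \<bullet> G u\<bar> \<le> (\<beta> - \<mu>) / 2 / 2 * (norm (v - u))\<^sup>2" for u v
  proof -
    have D: "GDERIV f u :> grad f u"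
      using diff by (rule GDERIV_grad)
    define p q where "p = \<mu> / 2 * (norm (v - u))\<^sup>2" and "q = \<beta> / 2 * (norm (v - u))\<^sup>2"
    have "F v - F u - (v - u) \<bullet> G u
        = f v - f u - (v - u) \<bullet> grad f u - c / 2 * (norm (v - u))\<^sup>2"
      unfolding F_def G_def power2_norm_eq_inner
      by (simp add: inner_simps inner_commute field_simps)
    also have "c / 2 * (norm (v - u))\<^sup>2 = (p + q) / 2"
      by (simp add: c_def p_def q_def field_simps)
    finally have F: "F v - F u - (v - u) \<bullet> G u = f v - f u - (v - u) \<bullet> grad f u - (p + q) / 2" .
    have "f u + (v - u) \<bullet> grad f u \<le> f v - p"
      using convex_quadratic_plus_bound[of "- \<mu>" 1 f u "grad f u" v] sc D
      by (simp add: strongly_convex_def p_def)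
    moreover have "f v \<le> f u + (v - u) \<bullet> grad f u + q"
      using convex_quadratic_plus_bound[of \<beta> "- 1" f u "grad f u" v] sm D
      by (simp add: beta_smooth_def q_def)
    ultimately have "\<bar>F v - F u - (v - u) \<bullet> G u\<bar> \<le> (q - p) / 2"
      unfolding F abs_le_iff by (simp add: field_simps)
    then show ?thesis by (simp add: p_def q_def field_simps)
  qed
  from lipschitz_gradient_of_paraboloid_bounds[of F G, OF this, of x y]
  show ?thesis by (simp add: G_def c_def algebra_simps)
qed

lemma gradient_step_lipschitz:
  fixes d e :: "'a::euclidean_space"
  assumes ball: "norm (e - ((\<mu> + \<beta>) / 2) *\<^sub>R d) \<le> (\<beta> - \<mu>) / 2 * norm d" and "0 \<le> \<tau>"
  shows "norm (d - \<tau> *\<^sub>R e) \<le> max \<bar>1 - \<tau> * \<mu>\<bar> \<bar>1 - \<tau> * \<beta>\<bar> * norm d"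
proof -
  let ?c = "(\<mu> + \<beta>) / 2" and ?r = "(\<beta> - \<mu>) / 2"
  have "norm (d - \<tau> *\<^sub>R e) = norm ((1 - \<tau> * ?c) *\<^sub>R d - \<tau> *\<^sub>R (e - ?c *\<^sub>R d))"
    by (simp add: algebra_simps)
  also have "\<dots> \<le> norm ((1 - \<tau> * ?c) *\<^sub>R d) + norm (\<tau> *\<^sub>R (e - ?c *\<^sub>R d))"
    by (rule norm_triangle_ineq4)
  also have "\<dots> \<le> \<bar>1 - \<tau> * ?c\<bar> * norm d + \<tau> * (?r * norm d)"
    using mult_left_mono[OF ball \<open>0 \<le> \<tau>\<close>] \<open>0 \<le> \<tau>\<close> by simp
  also have "\<dots> = (\<bar>1 - \<tau> * ?c\<bar> + \<tau> * ?r) * norm d"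
    by (simp add: algebra_simps)
  also have "\<dots> \<le> max \<bar>1 - \<tau> * \<mu>\<bar> \<bar>1 - \<tau> * \<beta>\<bar> * norm d"
  proof (rule mult_right_mono)
    have "\<bar>1 - (p + q) / 2\<bar> + (q - p) / 2 \<le> max \<bar>1 - p\<bar> \<bar>1 - q\<bar>" for p q :: real
      using abs_ge_self[of "1 - p"] abs_ge_minus_self[of "1 - q"]
      by (cases "(p + q) / 2 \<le> 1") (simp_all add: field_simps le_max_iff_disj)
    from this[of "\<tau> * \<mu>" "\<tau> * \<beta>"]
    show "\<bar>1 - \<tau> * ?c\<bar> + \<tau> * ?r \<le> max \<bar>1 - \<tau> * \<mu>\<bar> \<bar>1 - \<tau> * \<beta>\<bar>"
      by (simp add: distrib_left right_diff_distrib)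
  qed simp
  finally show ?thesis .
qed

lemma gradient_difference_bounds:
  fixes d e :: "'a::euclidean_space"
  assumes ball: "norm (e - ((\<mu> + \<beta>) / 2) *\<^sub>R d) \<le> (\<beta> - \<mu>) / 2 * norm d" and "0 \<le> \<mu> + \<beta>"
  shows "norm e \<le> \<beta> * norm d" and "\<mu> * norm d \<le> norm e"
proof -
  let ?c = "(\<mu> + \<beta>) / 2"
  have c: "norm (?c *\<^sub>R d) = ?c * norm d"
    using \<open>0 \<le> \<mu> + \<beta>\<close> by simp
  show "norm e \<le> \<beta> * norm d"
    using norm_triangle_sub[of e "?c *\<^sub>R d"] ball unfolding c by (simp add: field_simps)
  show "\<mu> * norm d \<le> norm e"
    using norm_triangle_sub[of "?c *\<^sub>R d" e] ball unfolding c
    by (simp add: norm_minus_commute field_simps)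
qed

lemma grad_eq_0_at_minimizer:
  fixes f :: "'a::euclidean_space \<Rightarrow> real"
  assumes "f differentiable (at x)" and min: "\<And>y. f x \<le> f y"
  shows "grad f x = 0"
proof -
  have "(f has_derivative (\<lambda>v. v \<bullet> grad f x)) (at x)"
    using GDERIV_grad[OF assms(1)] by (simp add: gderiv_def)
  then have "(\<lambda>v. v \<bullet> grad f x) = (\<lambda>v. 0)"
    by (rule has_derivative_local_min) (simp add: min)
  then have "grad f x \<bullet> grad f x = 0" by (rule fun_cong)
  then show ?thesis by simp
qed

lemma unique_minimizer_with_zero_grad:
  fixes f :: "'a::euclidean_space \<Rightarrow> real"
  assumes diff: "\<And>x. f differentiable (at x)"
    and sc: "strongly_convex \<mu> f" and sm: "beta_smooth \<beta> f" and pos: "0 < \<mu>" "0 < \<beta>"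
    and ex: "\<exists>x. \<forall>y. f x \<le> f y"
  obtains x_star where "\<And>x. (\<forall>y. f x \<le> f y) \<longleftrightarrow> x = x_star" and "grad f x_star = 0"
proof -
  obtain x_star where min: "\<forall>y. f x_star \<le> f y"
    using ex by blast
  then have g0: "grad f x_star = 0"
    using diff by (blast intro: grad_eq_0_at_minimizer)
  have "x = x_star" if "\<forall>y. f x \<le> f y" for x
  proof -
    have "grad f x = 0"
      using that diff by (blast intro: grad_eq_0_at_minimizer)
    then have "\<mu> * norm (x - x_star) \<le> 0"
      using gradient_difference_bounds(2)[OF grad_diff_in_ball[OF diff sc sm], of x x_star] g0 pos
      by simp
    with pos show ?thesis by (simp add: mult_le_0_iff)
  qed
  with min g0 that show ?thesis by blast
qed

section \<open>Shrinkage\<close>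

text \<open>If the thresholds have arbitrary signs, the inequality fails near \<open>0\<close>, where
  shrinkage with a negative threshold jumps. Against the threshold \<open>0\<close> it survives, because
  shrinkage then moves each argument by at most the absolute value of the threshold.\<close>

lemma shrink_diff_le:
  assumes "0 \<le> s \<and> 0 \<le> t \<or> t = 0"
  shows "\<bar>shrink s z - shrink t w\<bar> \<le> \<bar>z - w\<bar> + \<bar>s - t\<bar>"
proof -
  have "shrink u v = (if v > u \<and> v > 0 then v - u else if - v > u \<and> v < 0 then v + u else 0)"
    for u v
    by (simp add: shrink_def sgn_if abs_if)
  with assms show ?thesis by (smt (verit))
qed

lemma norm_shrinkage_diff_le:
  fixes s t z w :: "real ^ 'n"
  assumes "\<And>j. 0 \<le> s $ j \<and> 0 \<le> t $ j \<or> t $ j = 0"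
  shows "norm (shrinkage s z - shrinkage t w) \<le> norm (z - w) + norm (s - t)"
proof -
  define u v :: "real ^ 'n" where "u = (\<chi> j. \<bar>(z - w) $ j\<bar>)" and "v = (\<chi> j. \<bar>(s - t) $ j\<bar>)"
  have "norm (shrinkage s z - shrinkage t w) \<le> norm (u + v)"
    using shrink_diff_le[OF assms]
    by (intro norm_le_componentwise_cart) (simp add: shrinkage_def u_def v_def)
  also have "\<dots> \<le> norm u + norm v"
    by (rule norm_triangle_ineq)
  also have "\<dots> = norm (z - w) + norm (s - t)"
    by (simp add: u_def v_def norm_vec_def)
  finally show ?thesis .
qed

section \<open>The iteration\<close>

lemma sum_of_squares_contraction:
  fixes a b :: real
  assumes "s\<^sup>2 + k\<^sup>2 \<le> q" and "t\<^sup>2 + c\<^sup>2 \<le> q"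
  shows "(s * a + t * b)\<^sup>2 + (c * b + k * a)\<^sup>2 \<le> 2 * q * (a\<^sup>2 + b\<^sup>2)"
proof -
  have "(u + v)\<^sup>2 \<le> 2 * (u\<^sup>2 + v\<^sup>2)" for u v :: real
    using zero_le_power2[of "u - v"] by (simp add: power2_eq_square algebra_simps)
  from this[of "s * a" "t * b"] this[of "c * b" "k * a"]
  have "(s * a + t * b)\<^sup>2 + (c * b + k * a)\<^sup>2 \<le> 2 * ((s\<^sup>2 + k\<^sup>2) * a\<^sup>2 + (t\<^sup>2 + c\<^sup>2) * b\<^sup>2)"
    by (simp add: power_mult_distrib algebra_simps)
  also have "\<dots> \<le> 2 * (q * a\<^sup>2 + q * b\<^sup>2)"
    using assms by (intro mult_left_mono add_mono mult_right_mono) auto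
  finally show ?thesis by (simp add: algebra_simps)
qed

text \<open>The sign condition covers two uses: both points in the domain, for the Lipschitz
  property, and an arbitrary first point against the fixed point, whose multiplier is \<open>0\<close>.\<close>

lemma ista_step_contraction:
  fixes f :: "real ^ 'n \<Rightarrow> real" and x y l m :: "real ^ 'n"
  assumes diff: "\<And>x. f differentiable (at x)"
    and sc: "strongly_convex \<mu> f" and sm: "beta_smooth \<beta> f" and pos: "0 < \<mu>" "0 < \<beta>"
    and "0 \<le> \<tau>" and "\<alpha> \<le> 1"
    and q: "max ((1 - \<tau> * \<mu>)\<^sup>2) ((1 - \<tau> * \<beta>)\<^sup>2) + k\<^sub>i\<^sup>2 * \<beta>\<^sup>2 \<le> q" "\<tau>\<^sup>2 + (1 - \<alpha>)\<^sup>2 \<le> q"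
    and sign: "\<And>j. 0 \<le> l $ j \<and> 0 \<le> m $ j \<or> m $ j = 0"
  shows "dist (ista_step f \<tau> \<alpha> k\<^sub>i (x, l)) (ista_step f \<tau> \<alpha> k\<^sub>i (y, m))
    \<le> sqrt (2 * q) * dist (x, l) (y, m)"
proof -
  define e where "e = grad f x - grad f y"
  define s where "s = max \<bar>1 - \<tau> * \<mu>\<bar> \<bar>1 - \<tau> * \<beta>\<bar>"
  define a b where "a = norm (x - y)" and "b = norm (l - m)"
  have ball: "norm (e - ((\<mu> + \<beta>) / 2) *\<^sub>R (x - y)) \<le> (\<beta> - \<mu>) / 2 * norm (x - y)"
    unfolding e_def using diff sc sm by (rule grad_diff_in_ball)
  have step: "norm (x - y - \<tau> *\<^sub>R e) \<le> s * a"
    unfolding s_def a_def using ball \<open>0 \<le> \<tau>\<close> by (rule gradient_step_lipschitz)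
  have e: "norm e \<le> \<beta> * a"
    unfolding a_def using gradient_difference_bounds(1)[OF ball] pos by simp
  define X where "X = shrinkage (\<tau> *\<^sub>R l) (x - \<tau> *\<^sub>R grad f x)
    - shrinkage (\<tau> *\<^sub>R m) (y - \<tau> *\<^sub>R grad f y)"
  define \<Lambda> where "\<Lambda> = (1 - \<alpha>) *\<^sub>R (l - m) + k\<^sub>i *\<^sub>R e"
  have "norm X \<le> norm ((x - \<tau> *\<^sub>R grad f x) - (y - \<tau> *\<^sub>R grad f y)) + norm (\<tau> *\<^sub>R l - \<tau> *\<^sub>R m)"
    unfolding X_def
  proof (rule norm_shrinkage_diff_le)
    show "0 \<le> (\<tau> *\<^sub>R l) $ j \<and> 0 \<le> (\<tau> *\<^sub>R m) $ j \<or> (\<tau> *\<^sub>R m) $ j = 0" for j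
      using sign[of j] \<open>0 \<le> \<tau>\<close> by auto
  qed
  also have "(x - \<tau> *\<^sub>R grad f x) - (y - \<tau> *\<^sub>R grad f y) = x - y - \<tau> *\<^sub>R e"
    by (simp add: e_def algebra_simps)
  also have "norm (\<tau> *\<^sub>R l - \<tau> *\<^sub>R m) = \<tau> * b"
    using \<open>0 \<le> \<tau>\<close> by (simp add: b_def flip: scaleR_diff_right)
  finally have X: "norm X \<le> s * a + \<tau> * b"
    using step by linarith
  have "norm \<Lambda> \<le> norm ((1 - \<alpha>) *\<^sub>R (l - m)) + norm (k\<^sub>i *\<^sub>R e)"
    unfolding \<Lambda>_def by (rule norm_triangle_ineq)
  then have \<Lambda>: "norm \<Lambda> \<le> (1 - \<alpha>) * b + (\<bar>k\<^sub>i\<bar> * \<beta>) * a"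
    using mult_left_mono[OF e, of "\<bar>k\<^sub>i\<bar>"] \<open>\<alpha> \<le> 1\<close> by (simp add: b_def mult.assoc)
  have "s\<^sup>2 \<le> max ((1 - \<tau> * \<mu>)\<^sup>2) ((1 - \<tau> * \<beta>)\<^sup>2)"
    by (auto simp: s_def max_def)
  with q have "s\<^sup>2 + (\<bar>k\<^sub>i\<bar> * \<beta>)\<^sup>2 \<le> q"
    by (simp add: power_mult_distrib)
  then have "(s * a + \<tau> * b)\<^sup>2 + ((1 - \<alpha>) * b + (\<bar>k\<^sub>i\<bar> * \<beta>) * a)\<^sup>2 \<le> 2 * q * (a\<^sup>2 + b\<^sup>2)"
    using q(2) by (rule sum_of_squares_contraction)
  moreover have "(norm X)\<^sup>2 \<le> (s * a + \<tau> * b)\<^sup>2"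
    using X by (intro power_mono) auto
  moreover have "(norm \<Lambda>)\<^sup>2 \<le> ((1 - \<alpha>) * b + (\<bar>k\<^sub>i\<bar> * \<beta>) * a)\<^sup>2"
    using \<Lambda> by (intro power_mono) auto
  ultimately have "sqrt ((norm X)\<^sup>2 + (norm \<Lambda>)\<^sup>2) \<le> sqrt (2 * q * (a\<^sup>2 + b\<^sup>2))"
    by (intro real_sqrt_le_mono) linarith
  moreover have "ista_step f \<tau> \<alpha> k\<^sub>i (x, l) - ista_step f \<tau> \<alpha> k\<^sub>i (y, m) = (X, \<Lambda>)"
    by (simp add: ista_step_def X_def \<Lambda>_def e_def algebra_simps)
  ultimately show ?thesis
    by (simp add: dist_norm norm_Pair a_def b_def real_sqrt_mult)
qed

lemma ista_step_fixed_point: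
  assumes "grad f x = 0"
  shows "ista_step f \<tau> \<alpha> k\<^sub>i (x, 0) = (x, 0)"
  using assms by (simp add: ista_step_def shrinkage_def shrink_def vec_eq_iff)

lemma funpow_tendsto_fixed_point:
  fixes T :: "'a::metric_space \<Rightarrow> 'a"
  assumes "0 \<le> L" "L < 1" and step: "\<And>z. dist (T z) p \<le> L * dist z p"
  shows "(\<lambda>k. (T ^^ k) z) \<longlonglongrightarrow> p"
proof -
  have bound: "dist ((T ^^ k) z) p \<le> L ^ k * dist z p" for k
  proof (induction k)
    case (Suc k)
    have "dist ((T ^^ Suc k) z) p \<le> L * dist ((T ^^ k) z) p"
      using step by simp
    also have "\<dots> \<le> L * (L ^ k * dist z p)"
      using Suc \<open>0 \<le> L\<close> by (rule mult_left_mono)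
    finally show ?case by (simp add: mult.assoc)
  qed simp
  have "(\<lambda>k. L ^ k * dist z p) \<longlonglongrightarrow> 0"
    using LIMSEQ_realpow_zero[OF assms(1,2)] by (rule tendsto_mult_left_zero)
  then have "(\<lambda>k. dist ((T ^^ k) z) p) \<longlonglongrightarrow> 0"
    by (rule tendsto_sandwich[rotated 2, OF tendsto_const]) (simp_all add: bound)
  then show ?thesis by (subst tendsto_dist_iff)
qed

theorem proposition1:
  fixes f :: "real ^ 'n \<Rightarrow> real"
    and \<mu> \<beta> \<alpha> \<tau> k\<^sub>i :: real
  assumes f_nonneg: "\<And>x. 0 \<le> f x"
    and f_diff: "\<And>x. f differentiable (at x)"
    and mu_pos: "0 < \<mu>" and f_sc: "strongly_convex \<mu> f"
    and beta_pos: "0 < \<beta>" and f_sm: "beta_smooth \<beta> f"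
    and f_min: "\<exists>x. \<forall>y. f x \<le> f y"
    and alpha: "0 < \<alpha>" "\<alpha> < 1"
    and tau: "0 < \<tau>" "\<tau> < 2 / \<beta>"
    and xi: "max (max ((1 - \<tau> * \<mu>)\<^sup>2) ((1 - \<tau> * \<beta>)\<^sup>2) + k\<^sub>i\<^sup>2 * \<beta>\<^sup>2)
                 (\<tau>\<^sup>2 + (1 - \<alpha>)\<^sup>2) < 1 / 2"
  shows "(\<exists>L<1. L-lipschitz_on ista_domain (ista_step f \<tau> \<alpha> k\<^sub>i)) \<and>
         (\<exists>x_star. (\<forall>x. (\<forall>y. f x \<le> f y) \<longleftrightarrow> x = x_star) \<and>
            grad f x_star = 0 \<and>
            (\<forall>z0\<in>ista_domain.
               (\<lambda>k. (ista_step f \<tau> \<alpha> k\<^sub>i ^^ k) z0) \<longlonglongrightarrow> (x_star, 0)))"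
proof -
  define q where "q = max (max ((1 - \<tau> * \<mu>)\<^sup>2) ((1 - \<tau> * \<beta>)\<^sup>2) + k\<^sub>i\<^sup>2 * \<beta>\<^sup>2) (\<tau>\<^sup>2 + (1 - \<alpha>)\<^sup>2)"
  have q: "max ((1 - \<tau> * \<mu>)\<^sup>2) ((1 - \<tau> * \<beta>)\<^sup>2) + k\<^sub>i\<^sup>2 * \<beta>\<^sup>2 \<le> q" "\<tau>\<^sup>2 + (1 - \<alpha>)\<^sup>2 \<le> q"
    by (simp_all add: q_def)
  have "0 \<le> q"
    using q(2) by (smt (verit) zero_le_power2)
  then have L: "0 \<le> sqrt (2 * q)" "sqrt (2 * q) < 1"
    using xi by (simp_all flip: q_def)
  have contraction: "dist (ista_step f \<tau> \<alpha> k\<^sub>i (x, l)) (ista_step f \<tau> \<alpha> k\<^sub>i (y, m))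
      \<le> sqrt (2 * q) * dist (x, l) (y, m)"
    if "\<And>j. 0 \<le> l $ j \<and> 0 \<le> m $ j \<or> m $ j = 0" for x y l m
    using that alpha tau q mu_pos beta_pos f_diff f_sc f_sm
    by (intro ista_step_contraction[of f \<mu> \<beta>]) auto
  have "(sqrt (2 * q))-lipschitz_on ista_domain (ista_step f \<tau> \<alpha> k\<^sub>i)"
  proof (rule lipschitz_onI)
    fix z w :: "(real ^ 'n) \<times> (real ^ 'n)"
    assume "z \<in> ista_domain" "w \<in> ista_domain"
    then show "dist (ista_step f \<tau> \<alpha> k\<^sub>i z) (ista_step f \<tau> \<alpha> k\<^sub>i w) \<le> sqrt (2 * q) * dist z w"
      using contraction[of "snd z" "snd w" "fst z" "fst w"] by (simp add: ista_domain_def mem_Times_iff)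
  qed (fact L(1))
  moreover
  obtain x_star where x_star: "\<And>x. (\<forall>y. f x \<le> f y) \<longleftrightarrow> x = x_star" and g0: "grad f x_star = 0"
    using unique_minimizer_with_zero_grad[OF f_diff f_sc f_sm mu_pos beta_pos f_min] by blast
  have "dist (ista_step f \<tau> \<alpha> k\<^sub>i z) (x_star, 0) \<le> sqrt (2 * q) * dist z (x_star, 0)" for z
    using contraction[of "snd z" 0 "fst z" x_star] by (simp add: ista_step_fixed_point[OF g0])
  then have "(\<lambda>k. (ista_step f \<tau> \<alpha> k\<^sub>i ^^ k) z0) \<longlonglongrightarrow> (x_star, 0)" for z0
    by (rule funpow_tendsto_fixed_point[OF L])
  ultimately show ?thesis
    using L(2) x_star g0 by blast
qed

end
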